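(* Let $(L,\leq,0,1)$ be a bounded lattice, $a\in L\setminus\{0,1\}$, and let $T_1:[a,1]^2\to[a,1]$ and $T_2:[0,a]^2\to[0,a]$ be two t-subnorms on the subintervals $[a,1]$ and $[0,a]$ of $L$, respectively. Let $T:L^2\to L$ be defined by $$T(x,y)=\begin{cases} T_1(x,y), & (x,y)\in[a,1)^2,\\ T_2(x,y), & (x,y)\in[0,a)^2,\\ x\wedge y, & (x,y)\in \big([0,a)\times[a,1)\big)\cup\big([a,1)\times[0,a)\big)\cup\big(L\times\{1\}\big)\cup\big(\{1\}\times L\big),\\ T_2(x\wedge a,y\wedge a), & \text{otherwise.}\end{cases}$$ Then the following statements are equivalent: (I) $T$ is a t-norm on $L$. (II) $\{x\in L: x\in I_a \text{ and } T_2(x\wedge a,a)<x\wedge a\}=\emptyset$. (III) $I_a=\emptyset$ or $T_2(z\wedge a,a)=z\wedge a$ for all $z\in I_a$.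
   Context: A bounded lattice $(L,\leq,0,1)$ is a lattice with bottom element $0$ and top element $1$; $\wedge$ denotes the meet (greatest lower bound). For $c\leq d$ in $L$, $[c,d]=\{x\in L: c\leq x\leq d\}$ and $[c,d)=\{x\in L: c\leq x<d\}$, where $x<y$ means $x\leq y$ and $x\neq y$. $I_a=\{x\in L: x\not\leq a \text{ and } a\not\leq x\}$ is the set of elements of $L$ incomparable with $a$. A t-norm on a subinterval $[c,d]$ of $L$ is a binary operation $F:[c,d]^2\to[c,d]$ that is commutative, associative, increasing (if $x\leq y$ then $F(x,z)\leq F(y,z)$ for all $z\in[c,d]$), and has neutral element $d$, i.e. $F(d,x)=x$ for all $x\in[c,d]$. A t-norm on $L$ is the case $[c,d]=[0,1]=L$. A t-subnorm on a subinterval $[c,d]$ of $L$ is a binary operation $F:[c,d]^2\to[c,d]$ that is commutative, associative, increasing in both arguments, and satisfies $F(x,y)\leq x\wedge y$ for all $x,y\in[c,d]$. *)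

theory Defs
  imports Main
begin

text \<open>
  An operation on a subinterval \<open>{c..d}\<close> is a total function on the ambient type that is required to
  map \<open>{c..d} \<times> {c..d}\<close> into \<open>{c..d}\<close>; its values elsewhere are unconstrained and irrelevant.
\<close>

definition t_norm_on :: "'a::lattice \<Rightarrow> 'a \<Rightarrow> ('a \<Rightarrow> 'a \<Rightarrow> 'a) \<Rightarrow> bool" where
  "t_norm_on c d F \<longleftrightarrow>
     (\<forall>x\<in>{c..d}. \<forall>y\<in>{c..d}. F x y \<in> {c..d}) \<and>
     (\<forall>x\<in>{c..d}. \<forall>y\<in>{c..d}. F x y = F y x) \<and>
     (\<forall>x\<in>{c..d}. \<forall>y\<in>{c..d}. \<forall>z\<in>{c..d}. F (F x y) z = F x (F y z)) \<and>
     (\<forall>x\<in>{c..d}. \<forall>y\<in>{c..d}. \<forall>z\<in>{c..d}. x \<le> y \<longrightarrow> F x z \<le> F y z) \<and>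
     (\<forall>x\<in>{c..d}. F d x = x)"

definition t_subnorm_on :: "'a::lattice \<Rightarrow> 'a \<Rightarrow> ('a \<Rightarrow> 'a \<Rightarrow> 'a) \<Rightarrow> bool" where
  "t_subnorm_on c d F \<longleftrightarrow>
     (\<forall>x\<in>{c..d}. \<forall>y\<in>{c..d}. F x y \<in> {c..d}) \<and>
     (\<forall>x\<in>{c..d}. \<forall>y\<in>{c..d}. F x y = F y x) \<and>
     (\<forall>x\<in>{c..d}. \<forall>y\<in>{c..d}. \<forall>z\<in>{c..d}. F (F x y) z = F x (F y z)) \<and>
     (\<forall>x\<in>{c..d}. \<forall>y\<in>{c..d}. \<forall>z\<in>{c..d}. x \<le> y \<longrightarrow> F x z \<le> F y z \<and> F z x \<le> F z y) \<and>
     (\<forall>x\<in>{c..d}. \<forall>y\<in>{c..d}. F x y \<le> inf x y)"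

definition incomparables :: "'a::order \<Rightarrow> 'a set" where
  "incomparables a = {x. \<not> x \<le> a \<and> \<not> a \<le> x}"

definition ordinal_sum_op ::
  "'a::bounded_lattice \<Rightarrow> ('a \<Rightarrow> 'a \<Rightarrow> 'a) \<Rightarrow> ('a \<Rightarrow> 'a \<Rightarrow> 'a) \<Rightarrow> 'a \<Rightarrow> 'a \<Rightarrow> 'a" where
  "ordinal_sum_op a T1 T2 x y =
     (if (x, y) \<in> {a..<top} \<times> {a..<top} then T1 x y
      else if (x, y) \<in> {bot..<a} \<times> {bot..<a} then T2 x y
      else if (x, y) \<in> ({bot..<a} \<times> {a..<top}) \<union> ({a..<top} \<times> {bot..<a})
                       \<union> (UNIV \<times> {top}) \<union> ({top} \<times> UNIV) then inf x y
      else T2 (inf x a) (inf y a))"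

end

theory Submission
  imports Defs
begin

text \<open>
  Write \<open>p x = inf x a\<close>, and split the elements of \<open>L\<close> other than \<open>top\<close> into those above \<open>a\<close>
  (the upper ones) and the rest, which comprise both the elements strictly below \<open>a\<close> and those
  incomparable with \<open>a\<close>. The projection \<open>p\<close> sends every non-upper element strictly below \<open>a\<close>.

  If \<open>T2 (p z) a = p z\<close> for all \<open>z\<close> incomparable with \<open>a\<close>, then the four-case definition of the
  ordinal sum \<open>T\<close> collapses to three uniform rules away from \<open>top\<close>: two upper elements are combined
  by \<open>T1\<close>, two non-upper elements by \<open>T2\<close> after projection, and an upper element \<open>y\<close> acts on a
  non-upper \<open>x\<close> by \<open>T x y = p x\<close>, whatever \<open>y\<close> is. Upper elements are closed under \<open>T\<close>, while a
  non-upper factor sends the result strictly below \<open>a\<close>, where \<open>p\<close> is the identity. Hence in a triple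
  product upper factors merely project the others, and associativity reduces to that of \<open>T1\<close> (no
  non-upper factor) or \<open>T2\<close> (three of them), the element \<open>top\<close> being neutral by definition. Monotonicity follows in the same way, together with
  \<open>T x y \<le> inf x y\<close>.

  Conversely, let \<open>T\<close> be a t-norm and \<open>x\<close> incomparable with \<open>a\<close>. Since \<open>p x < a\<close>, the mixed clause
  gives \<open>T (p x) a = p x\<close>, whereas the last clause gives \<open>T x a = T2 (p x) a\<close>; monotonicity along
  \<open>p x \<le> x\<close> forces \<open>p x \<le> T2 (p x) a\<close>, and the reverse inequality holds for every t-subnorm. As this
  reverse inequality always holds, the absence of a strict inequality is the same as equality, which
  is the equivalence of the last two conditions.
\<close>

lemma t_subnorm_onD:
  assumes "t_subnorm_on c d F" "x \<in> {c..d}" "y \<in> {c..d}"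
  shows t_subnorm_on_closed: "F x y \<in> {c..d}"
    and t_subnorm_on_commute: "F x y = F y x"
    and t_subnorm_on_le_left: "F x y \<le> x"
    and t_subnorm_on_le_right: "F x y \<le> y"
  using assms unfolding t_subnorm_on_def by simp_all

lemma t_subnorm_on_assoc:
  assumes "t_subnorm_on c d F" "x \<in> {c..d}" "y \<in> {c..d}" "z \<in> {c..d}"
  shows "F (F x y) z = F x (F y z)"
  using assms unfolding t_subnorm_on_def by blast

lemma t_subnorm_on_mono_left:
  assumes "t_subnorm_on c d F" "x \<in> {c..d}" "y \<in> {c..d}" "z \<in> {c..d}" "x \<le> y"
  shows "F x z \<le> F y z"
  using assms unfolding t_subnorm_on_def by blast

lemma ordinal_sum_op_top:
  fixes a :: "'a::bounded_lattice"
  shows "ordinal_sum_op a T1 T2 top y = y" "ordinal_sum_op a T1 T2 x top = x"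
  unfolding ordinal_sum_op_def by (auto simp: less_le top_unique)

text \<open>
  The necessity argument: \<open>inf x a\<close> lies strictly below \<open>a\<close>, so the ordinal sum treats its product
  with \<open>a\<close> as a meet, while the product of \<open>x\<close> itself with \<open>a\<close> is governed by \<open>T2\<close>. Monotonicity
  compares the two.
\<close>

lemma t_norm_ordinal_sum_imp_inf_le:
  fixes a :: "'a::bounded_lattice"
  assumes "a \<noteq> top" and norm: "t_norm_on bot top (ordinal_sum_op a T1 T2)"
    and x: "x \<in> incomparables a"
  shows "inf x a \<le> T2 (inf x a) a"
proof -
  from x have n: "\<not> x \<le> a" "\<not> a \<le> x" unfolding incomparables_def by auto
  have lt: "inf x a < a" using n by (metis inf.cobounded1 inf.cobounded2 less_le)
  have "a < top" using \<open>a \<noteq> top\<close> by (simp add: less_le)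
  moreover have "\<not> a \<le> inf x a" using n by simp
  ultimately have 1: "ordinal_sum_op a T1 T2 (inf x a) a = inf x a"
    unfolding ordinal_sum_op_def using lt by (simp add: inf.absorb1)
  have "x \<noteq> top" using n by auto
  moreover have "\<not> x < a" using n by (simp add: less_le)
  ultimately have 2: "ordinal_sum_op a T1 T2 x a = T2 (inf x a) a"
    unfolding ordinal_sum_op_def using n \<open>a \<noteq> top\<close> by simp
  have "ordinal_sum_op a T1 T2 (inf x a) a \<le> ordinal_sum_op a T1 T2 x a"
    using norm inf.cobounded1[of x a] unfolding t_norm_on_def
    by (metis atLeastAtMost_iff bot_least top_greatest)
  then show ?thesis by (simp only: 1 2)
qed

text \<open>
  The neutrality assumption makes the incomparable elements behave exactly like their projections
  to \<open>{..a}\<close> in products with everything but \<open>top\<close>, so that they can be treated together with the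
  elements strictly below \<open>a\<close>.
\<close>

locale projecting_ordinal_sum =
  fixes a :: "'a::bounded_lattice" and T1 T2 :: "'a \<Rightarrow> 'a \<Rightarrow> 'a"
  assumes T1: "t_subnorm_on a top T1" and T2: "t_subnorm_on bot a T2"
    and neutral: "\<And>z. z \<in> incomparables a \<Longrightarrow> T2 (inf z a) a = inf z a"
begin

abbreviation "T \<equiv> ordinal_sum_op a T1 T2"

lemma T_upper:
  assumes "a \<le> x" "x \<noteq> top" "a \<le> y" "y \<noteq> top"
  shows "T x y = T1 x y"
  using assms unfolding ordinal_sum_op_def by (simp add: less_le)

text \<open>
  For \<open>x < a\<close> the product is the meet, that is \<open>x\<close>; for incomparable \<open>x\<close> it is \<open>T2 (inf x a) a\<close>.
  Neutrality makes the two agree, although \<open>T2 x a = x\<close> may fail for \<open>x < a\<close>.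
\<close>

lemma T_lower_upper:
  assumes "\<not> a \<le> x" "a \<le> y" "y \<noteq> top"
  shows "T x y = inf x a" "T y x = inf x a"
proof -
  have xt: "x \<noteq> top" using assms by auto
  have ny: "\<not> y < a" using assms by (simp add: leD)
  have pa: "inf y a = a" using assms by (simp add: inf.absorb2)
  have "T x y = inf x a \<and> T y x = inf x a"
  proof (cases "x < a")
    case True
    then have "x \<le> y" using assms by simp
    then have "inf x y = x" "inf y x = x" "inf x a = x"
      using True by (simp_all add: inf.absorb1 inf.absorb2)
    then show ?thesis
      unfolding ordinal_sum_op_def using assms True ny by (simp add: less_le)
  next
    case False
    have I: "x \<in> incomparables a"
      using False assms unfolding incomparables_def by (auto simp: less_le)
    have "T x y = T2 (inf x a) a" "T y x = T2 a (inf x a)"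
      unfolding ordinal_sum_op_def using assms False ny xt pa by simp_all
    moreover have "T2 a (inf x a) = T2 (inf x a) a"
      using t_subnorm_on_commute[OF T2] by simp
    ultimately show ?thesis using neutral[OF I] by simp
  qed
  then show "T x y = inf x a" "T y x = inf x a" by auto
qed

lemma T_lower:
  assumes "\<not> a \<le> x" "\<not> a \<le> y"
  shows "T x y = T2 (inf x a) (inf y a)"
proof -
  have "x \<noteq> top" "y \<noteq> top" using assms by auto
  then show ?thesis
    unfolding ordinal_sum_op_def using assms by (auto simp: inf.absorb1)
qed

lemma T_commute: "T x y = T y x"
proof (cases "x = top \<or> y = top")
  case True
  then show ?thesis by (auto simp: ordinal_sum_op_top)
next
  case False
  then show ?thesis
    using t_subnorm_on_commute[OF T1, of x y] t_subnorm_on_commute[OF T2, of "inf x a" "inf y a"]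
    by (cases "a \<le> x"; cases "a \<le> y") (simp_all add: T_upper T_lower_upper T_lower)
qed

lemma T_upper_closed:
  assumes "a \<le> x" "x \<noteq> top" "a \<le> y" "y \<noteq> top"
  shows "a \<le> T x y" "T x y \<noteq> top"
  using assms t_subnorm_on_closed[OF T1, of x y] t_subnorm_on_le_left[OF T1, of x y]
  by (auto simp: T_upper top_unique)

lemma T2_projections:
  shows T2_le_left: "T2 (inf x a) (inf y a) \<le> inf x a"
    and T2_le_right: "T2 (inf x a) (inf y a) \<le> inf y a"
    and inf_T2: "inf (T2 (inf x a) (inf y a)) a = T2 (inf x a) (inf y a)"
  using t_subnorm_onD[OF T2, of "inf x a" "inf y a"] by (auto simp: inf.absorb1)

lemma T2_not_upper:
  assumes "\<not> a \<le> x"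
  shows "\<not> a \<le> T2 (inf x a) (inf y a)"
proof
  assume "a \<le> T2 (inf x a) (inf y a)"
  also have "\<dots> \<le> x" using T2_le_left[of x y] by simp
  finally show False using assms by simp
qed

lemma T_le_right: "T x y \<le> y"
proof (cases "x = top \<or> y = top")
  case True
  then show ?thesis by (auto simp: ordinal_sum_op_top)
next
  case False
  show ?thesis
  proof (cases "a \<le> y")
    case True
    then show ?thesis
      using False t_subnorm_on_le_right[OF T1, of x y] le_infI2[OF True, of x]
      by (cases "a \<le> x") (simp_all add: T_upper T_lower_upper)
  next
    case ny: False
    then show ?thesis
      using False T2_le_right[of x y]
      by (cases "a \<le> x") (simp_all add: T_lower T_lower_upper)
  qed
qed

text \<open>
  If no factor is \<open>top\<close> and some factor is not above \<open>a\<close>, both bracketings are the \<open>T2\<close>-product of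
  the projections of the factors not above \<open>a\<close>: a partial product involving one of these is
  already strictly below \<open>a\<close>, so projecting it again changes nothing.
\<close>

lemma T_assoc: "T (T x y) z = T x (T y z)"
proof (cases "x = top \<or> y = top \<or> z = top")
  case True
  then show ?thesis by (auto simp: ordinal_sum_op_top)
next
  case False
  then have nt: "x \<noteq> top" "y \<noteq> top" "z \<noteq> top" by auto
  note rules = nt T_lower_upper T_lower T_upper_closed inf_T2 T2_not_upper
  show ?thesis
  proof (cases "a \<le> x \<and> a \<le> y \<and> a \<le> z")
    case True
    then have "T (T x y) z = T1 (T1 x y) z" "T x (T y z) = T1 x (T1 y z)"
      using nt by (metis T_upper T_upper_closed)+
    then show ?thesis using True t_subnorm_on_assoc[OF T1, of x y z] by simp
  next
    case some_lower: False
    have "T2 (T2 (inf x a) (inf y a)) (inf z a) = T2 (inf x a) (T2 (inf y a) (inf z a))"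
      using t_subnorm_on_assoc[OF T2, of "inf x a" "inf y a" "inf z a"] by simp
    then show ?thesis
      using some_lower by (cases "a \<le> x"; cases "a \<le> y"; cases "a \<le> z") (simp_all add: rules)
  qed
qed

lemma T_mono_left:
  assumes "x \<le> y"
  shows "T x z \<le> T y z"
proof -
  consider "y = top" | "z = top" | "x \<noteq> top" "y \<noteq> top" "z \<noteq> top"
    using assms top_unique by blast
  then show ?thesis
  proof cases
    case 1
    then show ?thesis by (simp add: ordinal_sum_op_top T_le_right)
  next
    case 2
    then show ?thesis using assms by (simp add: ordinal_sum_op_top)
  next
    case nt: 3
    consider "a \<le> x" "a \<le> y" | "\<not> a \<le> x" "a \<le> y" | "\<not> a \<le> x" "\<not> a \<le> y"
      using assms order_trans by blast
    then show ?thesis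
    proof cases
      case 1
      then show ?thesis
        using nt assms t_subnorm_on_mono_left[OF T1, of x y z]
        by (cases "a \<le> z") (simp_all add: T_upper T_lower_upper)
    next
      case 2
      show ?thesis
      proof (cases "a \<le> z")
        case True
        then have "T x z \<le> a" using 2 nt by (simp add: T_lower_upper)
        also have "a \<le> T y z" using True 2 nt by (simp add: T_upper_closed)
        finally show ?thesis .
      next
        case False
        then show ?thesis using 2 nt T2_le_right[of x z] by (simp add: T_lower_upper T_lower)
      qed
    next
      case 3
      have "inf x a \<le> inf y a" using assms by (rule inf_mono) simp
      then show ?thesis
        using 3 nt t_subnorm_on_mono_left[OF T2, of "inf x a" "inf y a" "inf z a"]
        by (cases "a \<le> z") (simp_all add: T_lower_upper T_lower)
    qed
  qed
qed

lemma t_norm_ordinal_sum: "t_norm_on bot top T"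
  unfolding t_norm_on_def
  using T_commute T_assoc T_mono_left by (simp add: ordinal_sum_op_top)

end

theorem theorem5:
  fixes a :: "'a::bounded_lattice"
    and T1 T2 :: "'a \<Rightarrow> 'a \<Rightarrow> 'a"
  assumes "a \<noteq> bot" and "a \<noteq> top"
    and "t_subnorm_on a top T1" and "t_subnorm_on bot a T2"
  shows "(t_norm_on bot top (ordinal_sum_op a T1 T2) \<longleftrightarrow>
            {x. x \<in> incomparables a \<and> T2 (inf x a) a < inf x a} = {}) \<and>
         ({x. x \<in> incomparables a \<and> T2 (inf x a) a < inf x a} = {} \<longleftrightarrow>
            incomparables a = {} \<or> (\<forall>z\<in>incomparables a. T2 (inf z a) a = inf z a))"
proof -
  have le: "T2 (inf z a) a \<le> inf z a" for z
    using t_subnorm_on_le_left[OF assms(4), of "inf z a" a] by simp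
  have II_III: "{x. x \<in> incomparables a \<and> T2 (inf x a) a < inf x a} = {} \<longleftrightarrow>
      (\<forall>z\<in>incomparables a. T2 (inf z a) a = inf z a)"
    using le by (auto simp: less_le)
  have I_III: "t_norm_on bot top (ordinal_sum_op a T1 T2) \<longleftrightarrow>
      (\<forall>z\<in>incomparables a. T2 (inf z a) a = inf z a)"
  proof
    assume "t_norm_on bot top (ordinal_sum_op a T1 T2)"
    then show "\<forall>z\<in>incomparables a. T2 (inf z a) a = inf z a"
      using t_norm_ordinal_sum_imp_inf_le[OF assms(2)] le by (blast intro: order_antisym)
  next
    assume "\<forall>z\<in>incomparables a. T2 (inf z a) a = inf z a"
    then interpret projecting_ordinal_sum a T1 T2
      using assms(3,4) by unfold_locales auto
    show "t_norm_on bot top (ordinal_sum_op a T1 T2)"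
      by (rule t_norm_ordinal_sum)
  qed
  show ?thesis using II_III I_III by auto
qed

end
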